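(* For every assertion $A$ over $\mathcal{L}_\infty$: if $\vdash A$ then $\models A$, i.e. every assertion derivable in the proof system holds in every transition system.
   Context: A transition system is $(\mathrm{Proc},\mathsf{Act},\rightarrow,\uparrow)$ with $\rightarrow\subseteq\mathrm{Proc}\times\mathsf{Act}\times\mathrm{Proc}$ and a divergence predicate $\uparrow\subseteq\mathrm{Proc}$ ($p\downarrow$ means not $p\uparrow$). The language $\mathcal{L}_\infty$ has two sorts $\pi$ (process) and $\kappa$ (capability): formulas of each sort are closed under arbitrary conjunctions $\bigwedge_{i\in I}$ and disjunctions $\bigvee_{i\in I}$ (with $t$ (true) the empty conjunction and $f$ (false) the empty disjunction); if $a\in\mathsf{Act}$ and $\phi$ has sort $\pi$ then $a(\phi)$ has sort $\kappa$; if $\phi$ has sort $\kappa$ then $\Box\phi,\Diamond\phi$ have sort $\pi$. Let $\mathrm{Cap}=\{\bot\}\cup(\mathsf{Act}\times\mathrm{Proc})$ and $C(p)=\{\bot: p\uparrow\}\cup\{\langle a,q\rangle: p\xrightarrow{a}q\}$. Satisfaction: conjunction/disjunction as usual; $p\models\Box\phi$ iff every $c\in C(p)$ satisfies $\phi$; $p\models\Diamond\phi$ iff some $c\in C(p)\cup\{\bot\}$ satisfies $\phi$; $c\models a(\phi)$ iff $c=\langle a,q\rangle$ with $q\models\phi$. Assertions are $\phi\le_\sigma\psi$, $\phi=_\sigma\psi$; a transition system satisfies $\phi\le\psi$ if every element of the relevant sort ($\mathrm{Proc}$ or $\mathrm{Cap}$) satisfying $\phi$ satisfies $\psi$ (similarly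 for $=$), and $\models A$ means $A$ holds in all transition systems. The predicate $\phi\downarrow$ is defined by: $(\bigwedge_i\phi_i)\downarrow$ iff some $\phi_i\downarrow$; $(\bigvee_i\phi_i)\downarrow$ iff all $\phi_i\downarrow$; $a(\phi)\downarrow$ always; $(\Box\phi)\downarrow$ and $(\Diamond\phi)\downarrow$ iff $\phi\downarrow$. The proof system $\vdash$ consists of the distributive lattice axioms (reflexivity, transitivity, $t$ top, $f$ bottom, meet/join introduction and elimination, distributivity, with arbitrary index sets) plus: $\phi\le\psi\Rightarrow a(\phi)\le a(\psi)$; $a(\bigwedge_{i\in I}\phi_i)=\bigwedge_{i\in I}a(\phi_i)$ for $I\ne\varnothing$; $a(\phi)\wedge b(\psi)=f$ for $a\ne b$; $a(\bigvee_i\phi_i)=\bigvee_i a(\phi_i)$; $\phi\le\psi\Rightarrow\Box\phi\le\Box\psi$; $\Box\bigwedge_i\phi_i=\bigwedge_i\Box\phi_i$; $\phi\le\psi\Rightarrow\Diamond\phi\le\Diamond\psi$; $\Diamond\bigvee_i\phi_i=\bigvee_i\Diamond\phi_i$; $\Box(\phi\vee\psi)\le\Box\phi\vee\Diamond\psi$; $\Box\phi\wedge\Diamond\psi\le\Diamond(\phi\wedge\psi)$ when $\psi\downarrow$; $\Diamond t=t$. *)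

theory Defs
  imports Main "HOL-Library.FuncSet"
begin

(* Act is the type 'a.  A family indexed by a set I is a partial function with domain I on a
   type 'i.  Since any formula or derivation uses only a set of indices, quantifying over
   the type 'i accounts for arbitrary index sets. *)
datatype ('a, 'i) pform =
    PAnd "'i \<rightharpoonup> ('a, 'i) pform"
  | POr "'i \<rightharpoonup> ('a, 'i) pform"
  | Box "('a, 'i) cform"
  | Dia "('a, 'i) cform"
and ('a, 'i) cform =
    CAnd "'i \<rightharpoonup> ('a, 'i) cform"
  | COr "'i \<rightharpoonup> ('a, 'i) cform"
  | Pref 'a "('a, 'i) pform"

definition family :: "'i set \<Rightarrow> ('i \<Rightarrow> 'b) \<Rightarrow> ('i \<rightharpoonup> 'b)" where
  "family I \<phi> = (\<lambda>i. if i \<in> I then Some (\<phi> i) else None)"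

lemma family_cases: obtains I \<phi> where "F = family I \<phi>"
proof
  show "F = family (dom F) (\<lambda>i. the (F i))" by (auto simp: family_def fun_eq_iff)
qed

definition PConj :: "'i set \<Rightarrow> ('i \<Rightarrow> ('a, 'i) pform) \<Rightarrow> ('a, 'i) pform" where
  "PConj I \<phi> = PAnd (family I \<phi>)"
definition PDisj :: "'i set \<Rightarrow> ('i \<Rightarrow> ('a, 'i) pform) \<Rightarrow> ('a, 'i) pform" where
  "PDisj I \<phi> = POr (family I \<phi>)"
definition CConj :: "'i set \<Rightarrow> ('i \<Rightarrow> ('a, 'i) cform) \<Rightarrow> ('a, 'i) cform" where
  "CConj I \<phi> = CAnd (family I \<phi>)"
definition CDisj :: "'i set \<Rightarrow> ('i \<Rightarrow> ('a, 'i) cform) \<Rightarrow> ('a, 'i) cform" where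
  "CDisj I \<phi> = COr (family I \<phi>)"

definition PTrue :: "('a, 'i) pform" where "PTrue = PAnd Map.empty"
definition PFalse :: "('a, 'i) pform" where "PFalse = POr Map.empty"
definition CTrue :: "('a, 'i) cform" where "CTrue = CAnd Map.empty"
definition CFalse :: "('a, 'i) cform" where "CFalse = COr Map.empty"

(* Binary connectives are conjunctions and disjunctions over a two-element index set {i, j};
   they are meant for \<open>i \<noteq> j\<close> only. *)
definition PMeet :: "'i \<Rightarrow> 'i \<Rightarrow> ('a, 'i) pform \<Rightarrow> ('a, 'i) pform \<Rightarrow> ('a, 'i) pform" where
  "PMeet i j \<phi> \<psi> = PConj {i, j} (\<lambda>k. if k = i then \<phi> else \<psi>)"
definition PJoin :: "'i \<Rightarrow> 'i \<Rightarrow> ('a, 'i) pform \<Rightarrow> ('a, 'i) pform \<Rightarrow> ('a, 'i) pform" where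
  "PJoin i j \<phi> \<psi> = PDisj {i, j} (\<lambda>k. if k = i then \<phi> else \<psi>)"
definition CMeet :: "'i \<Rightarrow> 'i \<Rightarrow> ('a, 'i) cform \<Rightarrow> ('a, 'i) cform \<Rightarrow> ('a, 'i) cform" where
  "CMeet i j \<phi> \<psi> = CConj {i, j} (\<lambda>k. if k = i then \<phi> else \<psi>)"
definition CJoin :: "'i \<Rightarrow> 'i \<Rightarrow> ('a, 'i) cform \<Rightarrow> ('a, 'i) cform \<Rightarrow> ('a, 'i) cform" where
  "CJoin i j \<phi> \<psi> = CDisj {i, j} (\<lambda>k. if k = i then \<phi> else \<psi>)"

datatype ('a, 'i) assertion =
    PLe "('a, 'i) pform" "('a, 'i) pform" (infix "\<le>\<^sub>\<pi>" 50)
  | PEq "('a, 'i) pform" "('a, 'i) pform" (infix "=\<^sub>\<pi>" 50)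
  | CLe "('a, 'i) cform" "('a, 'i) cform" (infix "\<le>\<^sub>\<kappa>" 50)
  | CEq "('a, 'i) cform" "('a, 'i) cform" (infix "=\<^sub>\<kappa>" 50)

record ('a, 'p) ts =
  procs :: "'p set"
  step :: "('p \<times> 'a \<times> 'p) set"
  diverg :: "'p set"

definition transition_system :: "('a, 'p) ts \<Rightarrow> bool" where
  "transition_system T \<longleftrightarrow>
     step T \<subseteq> procs T \<times> UNIV \<times> procs T \<and> diverg T \<subseteq> procs T"

datatype ('a, 'p) capability = Bot | Act 'a 'p

definition Cap :: "('a, 'p) ts \<Rightarrow> ('a, 'p) capability set" where
  "Cap T = {Bot} \<union> {Act a q |a q. q \<in> procs T}"

definition caps :: "('a, 'p) ts \<Rightarrow> 'p \<Rightarrow> ('a, 'p) capability set" where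
  "caps T p = (if p \<in> diverg T then {Bot} else {}) \<union> {Act a q |a q. (p, a, q) \<in> step T}"

(* Recursion through partial functions forces the \<open>map_option\<close> form of the clauses for
   families here and in pconv/cconv; sat_families and conv_families give the usual form. *)
primrec psat :: "('a, 'p) ts \<Rightarrow> ('a, 'i) pform \<Rightarrow> 'p \<Rightarrow> bool"
  and csat :: "('a, 'p) ts \<Rightarrow> ('a, 'i) cform \<Rightarrow> ('a, 'p) capability \<Rightarrow> bool" where
  "psat T (PAnd F) = (\<lambda>p. \<forall>s\<in>ran (map_option (psat T) \<circ> F). s p)"
| "psat T (POr F) = (\<lambda>p. \<exists>s\<in>ran (map_option (psat T) \<circ> F). s p)"
| "psat T (Box \<phi>) = (\<lambda>p. \<forall>c\<in>caps T p. csat T \<phi> c)"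
| "psat T (Dia \<phi>) = (\<lambda>p. \<exists>c\<in>caps T p \<union> {Bot}. csat T \<phi> c)"
| "csat T (CAnd F) = (\<lambda>c. \<forall>s\<in>ran (map_option (csat T) \<circ> F). s c)"
| "csat T (COr F) = (\<lambda>c. \<exists>s\<in>ran (map_option (csat T) \<circ> F). s c)"
| "csat T (Pref a \<phi>) = (\<lambda>c. \<exists>q. c = Act a q \<and> psat T \<phi> q)"

lemma sat_families [simp]:
  "psat T (PConj I \<phi>) p \<longleftrightarrow> (\<forall>i\<in>I. psat T (\<phi> i) p)"
  "psat T (PDisj I \<phi>) p \<longleftrightarrow> (\<exists>i\<in>I. psat T (\<phi> i) p)"
  "csat T (CConj I \<psi>) c \<longleftrightarrow> (\<forall>i\<in>I. csat T (\<psi> i) c)"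
  "csat T (CDisj I \<psi>) c \<longleftrightarrow> (\<exists>i\<in>I. csat T (\<psi> i) c)"
  by (auto simp: PConj_def PDisj_def CConj_def CDisj_def family_def ran_def)

primrec asat :: "('a, 'p) ts \<Rightarrow> ('a, 'i) assertion \<Rightarrow> bool" where
  "asat T (\<phi> \<le>\<^sub>\<pi> \<psi>) \<longleftrightarrow> (\<forall>p\<in>procs T. psat T \<phi> p \<longrightarrow> psat T \<psi> p)"
| "asat T (\<phi> =\<^sub>\<pi> \<psi>) \<longleftrightarrow> (\<forall>p\<in>procs T. psat T \<phi> p \<longleftrightarrow> psat T \<psi> p)"
| "asat T (\<phi> \<le>\<^sub>\<kappa> \<psi>) \<longleftrightarrow> (\<forall>c\<in>Cap T. csat T \<phi> c \<longrightarrow> csat T \<psi> c)"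
| "asat T (\<phi> =\<^sub>\<kappa> \<psi>) \<longleftrightarrow> (\<forall>c\<in>Cap T. csat T \<phi> c \<longleftrightarrow> csat T \<psi> c)"

(* Validity in all transition systems whose processes are drawn from the type 'p; a theorem
   polymorphic in 'p then speaks about all transition systems. *)
definition valid :: "'p itself \<Rightarrow> ('a, 'i) assertion \<Rightarrow> bool" where
  "valid _ A \<longleftrightarrow> (\<forall>T :: ('a, 'p) ts. transition_system T \<longrightarrow> asat T A)"

(* The predicate written \<open>\<phi>\<down>\<close> on formulas of either sort. *)
primrec pconv :: "('a, 'i) pform \<Rightarrow> bool"
  and cconv :: "('a, 'i) cform \<Rightarrow> bool" where
  "pconv (PAnd F) \<longleftrightarrow> True \<in> ran (map_option pconv \<circ> F)"
| "pconv (POr F) \<longleftrightarrow> False \<notin> ran (map_option pconv \<circ> F)"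
| "pconv (Box \<phi>) \<longleftrightarrow> cconv \<phi>"
| "pconv (Dia \<phi>) \<longleftrightarrow> cconv \<phi>"
| "cconv (CAnd F) \<longleftrightarrow> True \<in> ran (map_option cconv \<circ> F)"
| "cconv (COr F) \<longleftrightarrow> False \<notin> ran (map_option cconv \<circ> F)"
| "cconv (Pref a \<phi>) \<longleftrightarrow> True"

lemma conv_families [simp]:
  "pconv (PConj I \<phi>) \<longleftrightarrow> (\<exists>i\<in>I. pconv (\<phi> i))"
  "pconv (PDisj I \<phi>) \<longleftrightarrow> (\<forall>i\<in>I. pconv (\<phi> i))"
  "cconv (CConj I \<psi>) \<longleftrightarrow> (\<exists>i\<in>I. cconv (\<psi> i))"
  "cconv (CDisj I \<psi>) \<longleftrightarrow> (\<forall>i\<in>I. cconv (\<psi> i))"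
  by (auto simp: PConj_def PDisj_def CConj_def CDisj_def family_def ran_def)

(* Distributivity for arbitrary index sets is taken in its strongest form, complete
   distributivity, besides the two laws for a binary connective against an arbitrary family.
   The join in p_dist_complete and c_dist_complete runs over the choice functions in \<open>PiE I J\<close>, which are
   enumerated by an index set K. *)
inductive derivable :: "('a, 'i) assertion \<Rightarrow> bool" ("\<turnstile> _" [45] 45) where
p_refl: "\<turnstile> \<phi> \<le>\<^sub>\<pi> \<phi>"
| p_trans: "\<turnstile> \<phi> \<le>\<^sub>\<pi> \<psi> \<Longrightarrow> \<turnstile> \<psi> \<le>\<^sub>\<pi> \<chi> \<Longrightarrow> \<turnstile> \<phi> \<le>\<^sub>\<pi> \<chi>"
| p_eqI: "\<turnstile> \<phi> \<le>\<^sub>\<pi> \<psi> \<Longrightarrow> \<turnstile> \<psi> \<le>\<^sub>\<pi> \<phi> \<Longrightarrow> \<turnstile> \<phi> =\<^sub>\<pi> \<psi>"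
| p_eqE1: "\<turnstile> \<phi> =\<^sub>\<pi> \<psi> \<Longrightarrow> \<turnstile> \<phi> \<le>\<^sub>\<pi> \<psi>"
| p_eqE2: "\<turnstile> \<phi> =\<^sub>\<pi> \<psi> \<Longrightarrow> \<turnstile> \<psi> \<le>\<^sub>\<pi> \<phi>"
| p_top: "\<turnstile> \<phi> \<le>\<^sub>\<pi> PTrue"
| p_bot: "\<turnstile> PFalse \<le>\<^sub>\<pi> \<phi>"
| p_conjI: "(\<And>i. i \<in> I \<Longrightarrow> \<turnstile> \<phi> \<le>\<^sub>\<pi> \<psi> i) \<Longrightarrow> \<turnstile> \<phi> \<le>\<^sub>\<pi> PConj I \<psi>"
| p_conjE: "i \<in> I \<Longrightarrow> \<turnstile> PConj I \<phi> \<le>\<^sub>\<pi> \<phi> i"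
| p_disjI: "i \<in> I \<Longrightarrow> \<turnstile> \<phi> i \<le>\<^sub>\<pi> PDisj I \<phi>"
| p_disjE: "(\<And>i. i \<in> I \<Longrightarrow> \<turnstile> \<phi> i \<le>\<^sub>\<pi> \<psi>) \<Longrightarrow> \<turnstile> PDisj I \<phi> \<le>\<^sub>\<pi> \<psi>"
| p_dist_meet: "i \<noteq> j \<Longrightarrow>
    \<turnstile> PMeet i j \<phi> (PDisj I \<psi>) =\<^sub>\<pi> PDisj I (\<lambda>k. PMeet i j \<phi> (\<psi> k))"
| p_dist_join: "i \<noteq> j \<Longrightarrow>
    \<turnstile> PJoin i j \<phi> (PConj I \<psi>) =\<^sub>\<pi> PConj I (\<lambda>k. PJoin i j \<phi> (\<psi> k))"
| p_dist_complete: "bij_betw e K (PiE I J) \<Longrightarrow>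
    \<turnstile> PConj I (\<lambda>i. PDisj (J i) (\<lambda>j. \<theta> i j)) =\<^sub>\<pi> PDisj K (\<lambda>k. PConj I (\<lambda>i. \<theta> i (e k i)))"
| c_refl: "\<turnstile> \<phi> \<le>\<^sub>\<kappa> \<phi>"
| c_trans: "\<turnstile> \<phi> \<le>\<^sub>\<kappa> \<psi> \<Longrightarrow> \<turnstile> \<psi> \<le>\<^sub>\<kappa> \<chi> \<Longrightarrow> \<turnstile> \<phi> \<le>\<^sub>\<kappa> \<chi>"
| c_eqI: "\<turnstile> \<phi> \<le>\<^sub>\<kappa> \<psi> \<Longrightarrow> \<turnstile> \<psi> \<le>\<^sub>\<kappa> \<phi> \<Longrightarrow> \<turnstile> \<phi> =\<^sub>\<kappa> \<psi>"
| c_eqE1: "\<turnstile> \<phi> =\<^sub>\<kappa> \<psi> \<Longrightarrow> \<turnstile> \<phi> \<le>\<^sub>\<kappa> \<psi>"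
| c_eqE2: "\<turnstile> \<phi> =\<^sub>\<kappa> \<psi> \<Longrightarrow> \<turnstile> \<psi> \<le>\<^sub>\<kappa> \<phi>"
| c_top: "\<turnstile> \<phi> \<le>\<^sub>\<kappa> CTrue"
| c_bot: "\<turnstile> CFalse \<le>\<^sub>\<kappa> \<phi>"
| c_conjI: "(\<And>i. i \<in> I \<Longrightarrow> \<turnstile> \<phi> \<le>\<^sub>\<kappa> \<psi> i) \<Longrightarrow> \<turnstile> \<phi> \<le>\<^sub>\<kappa> CConj I \<psi>"
| c_conjE: "i \<in> I \<Longrightarrow> \<turnstile> CConj I \<phi> \<le>\<^sub>\<kappa> \<phi> i"
| c_disjI: "i \<in> I \<Longrightarrow> \<turnstile> \<phi> i \<le>\<^sub>\<kappa> CDisj I \<phi>"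
| c_disjE: "(\<And>i. i \<in> I \<Longrightarrow> \<turnstile> \<phi> i \<le>\<^sub>\<kappa> \<psi>) \<Longrightarrow> \<turnstile> CDisj I \<phi> \<le>\<^sub>\<kappa> \<psi>"
| c_dist_meet: "i \<noteq> j \<Longrightarrow>
    \<turnstile> CMeet i j \<phi> (CDisj I \<psi>) =\<^sub>\<kappa> CDisj I (\<lambda>k. CMeet i j \<phi> (\<psi> k))"
| c_dist_join: "i \<noteq> j \<Longrightarrow>
    \<turnstile> CJoin i j \<phi> (CConj I \<psi>) =\<^sub>\<kappa> CConj I (\<lambda>k. CJoin i j \<phi> (\<psi> k))"
| c_dist_complete: "bij_betw e K (PiE I J) \<Longrightarrow>
    \<turnstile> CConj I (\<lambda>i. CDisj (J i) (\<lambda>j. \<theta> i j)) =\<^sub>\<kappa> CDisj K (\<lambda>k. CConj I (\<lambda>i. \<theta> i (e k i)))"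
| pref_mono: "\<turnstile> \<phi> \<le>\<^sub>\<pi> \<psi> \<Longrightarrow> \<turnstile> Pref a \<phi> \<le>\<^sub>\<kappa> Pref a \<psi>"
| pref_conj: "I \<noteq> {} \<Longrightarrow> \<turnstile> Pref a (PConj I \<phi>) =\<^sub>\<kappa> CConj I (\<lambda>i. Pref a (\<phi> i))"
| pref_clash: "i \<noteq> j \<Longrightarrow> a \<noteq> b \<Longrightarrow> \<turnstile> CMeet i j (Pref a \<phi>) (Pref b \<psi>) =\<^sub>\<kappa> CFalse"
| pref_disj: "\<turnstile> Pref a (PDisj I \<phi>) =\<^sub>\<kappa> CDisj I (\<lambda>i. Pref a (\<phi> i))"
| box_mono: "\<turnstile> \<phi> \<le>\<^sub>\<kappa> \<psi> \<Longrightarrow> \<turnstile> Box \<phi> \<le>\<^sub>\<pi> Box \<psi>"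
| box_conj: "\<turnstile> Box (CConj I \<phi>) =\<^sub>\<pi> PConj I (\<lambda>i. Box (\<phi> i))"
| dia_mono: "\<turnstile> \<phi> \<le>\<^sub>\<kappa> \<psi> \<Longrightarrow> \<turnstile> Dia \<phi> \<le>\<^sub>\<pi> Dia \<psi>"
| dia_disj: "\<turnstile> Dia (CDisj I \<phi>) =\<^sub>\<pi> PDisj I (\<lambda>i. Dia (\<phi> i))"
| box_join: "i \<noteq> j \<Longrightarrow> \<turnstile> Box (CJoin i j \<phi> \<psi>) \<le>\<^sub>\<pi> PJoin i j (Box \<phi>) (Dia \<psi>)"
| dia_meet: "i \<noteq> j \<Longrightarrow> cconv \<psi> \<Longrightarrow> \<turnstile> PMeet i j (Box \<phi>) (Dia \<psi>) \<le>\<^sub>\<pi> Dia (CMeet i j \<phi> \<psi>)"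
| dia_true: "\<turnstile> Dia CTrue =\<^sub>\<pi> PTrue"

end

theory Submission
  imports Defs
begin

text \<open>Soundness is by induction on derivations.  The side condition \<open>\<psi>\<down>\<close> guarantees that \<open>\<bottom>\<close> does
  not satisfy \<open>\<psi>\<close>, so a capability witnessing \<open>\<diamond>\<psi>\<close> at \<open>p\<close> lies in \<open>C(p)\<close>, where \<open>\<box>\<phi>\<close> applies to it.\<close>

lemma sat_binary [simp]:
  assumes "i \<noteq> j"
  shows "psat T (PMeet i j \<phi> \<psi>) p \<longleftrightarrow> psat T \<phi> p \<and> psat T \<psi> p"
    and "psat T (PJoin i j \<phi> \<psi>) p \<longleftrightarrow> psat T \<phi> p \<or> psat T \<psi> p"
    and "csat T (CMeet i j \<phi>' \<psi>') c \<longleftrightarrow> csat T \<phi>' c \<and> csat T \<psi>' c"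
    and "csat T (CJoin i j \<phi>' \<psi>') c \<longleftrightarrow> csat T \<phi>' c \<or> csat T \<psi>' c"
  using assms by (auto simp: PMeet_def PJoin_def CMeet_def CJoin_def)

lemma sat_constants [simp]:
  "psat T PTrue p" "\<not> psat T PFalse p" "csat T CTrue c" "\<not> csat T CFalse c"
  by (simp_all add: PTrue_def PFalse_def CTrue_def CFalse_def)

text \<open>\<open>Bot\<close> satisfies no prefix formula. This failure passes to a conjunction
  from its one convergent conjunct and to a disjunction from all its disjuncts.\<close>

lemma cconv_not_csat_Bot: "cconv \<phi> \<Longrightarrow> \<not> csat T \<phi> Bot"
\<comment> \<open>Process formulas occur only below a prefix, where \<open>Bot\<close> fails
  outright, so the trivial predicate suffices for them.\<close>
proof (induction \<phi> rule: cform.induct[where ?P1.0 = "\<lambda>_. True"])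
  case (CAnd F)
  then show ?case
    by (fastforce simp: ran_def ranI)
next
  case (COr F)
  then show ?case
    by (fastforce simp: ran_def ranI)
qed simp_all

text \<open>Assertions of sort \<kappa> range over \<open>Cap T\<close> only, so induction
  hypotheses for the modal rules reach C(p) through this inclusion.\<close>

lemma caps_subset_Cap:
  assumes "transition_system T"
  shows "caps T p \<subseteq> Cap T"
  using assms by (auto simp: transition_system_def caps_def Cap_def)

text \<open>The semantic form of complete distributivity: by the axiom of choice, witnesses chosen
  for each \<open>i\<close> form a choice function, which \<open>e\<close> enumerates.\<close>

lemma ball_bex_choice_iff:
  assumes "bij_betw e K (PiE I J)"
  shows "(\<forall>i\<in>I. \<exists>j\<in>J i. P i j) \<longleftrightarrow> (\<exists>k\<in>K. \<forall>i\<in>I. P i (e k i))"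
proof
  assume "\<forall>i\<in>I. \<exists>j\<in>J i. P i j"
  then obtain f where f: "\<forall>i\<in>I. f i \<in> J i \<and> P i (f i)"
    by metis
  \<comment> \<open>\<open>PiE\<close> contains only functions that are undefined outside
    \<open>I\<close>, hence the restriction.\<close>
  then have "restrict f I \<in> e ` K"
    using assms by (auto simp: bij_betw_def)
  then obtain k where "k \<in> K" "e k = restrict f I"
    by force
  with f show "\<exists>k\<in>K. \<forall>i\<in>I. P i (e k i)"
    by (auto intro!: bexI[of _ k])
next
  assume "\<exists>k\<in>K. \<forall>i\<in>I. P i (e k i)"
  then show "\<forall>i\<in>I. \<exists>j\<in>J i. P i j"
    using bij_betwE[OF assms] by (blast dest: PiE_mem)
qed

lemma derivable_asat:
  assumes "\<turnstile> A" and T: "transition_system T"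
  shows "asat T A"
  using assms(1)
proof (induction rule: derivable.induct)
  case (p_dist_complete e K I J \<theta>)
  then show ?case by (simp add: ball_bex_choice_iff)
next
  case (c_dist_complete e K I J \<theta>)
  then show ?case by (simp add: ball_bex_choice_iff)
next
  case (pref_mono \<phi> \<psi> a)
  \<comment> \<open>For \<open>Act a q\<close> in \<open>Cap T\<close>, \<open>q\<close> is a
    process of \<open>T\<close>, so the hypothesis applies to it.\<close>
  then show ?case by (auto simp: Cap_def)
next
  case (box_mono \<phi> \<psi>)
  then show ?case using caps_subset_Cap[OF T] by fastforce
next
  case (dia_mono \<phi> \<psi>)
  moreover have "caps T p \<union> {Bot} \<subseteq> Cap T" for p
    using caps_subset_Cap[OF T] by (auto simp: Cap_def)
  ultimately show ?case by fastforce
next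
  case (dia_meet i j \<psi> \<phi>)
  then show ?case using cconv_not_csat_Bot[of \<psi> T] by auto
qed auto

theorem mainTheorem12:
  fixes A :: "('a, 'i) assertion"
  assumes "\<turnstile> A"
  shows "valid TYPE('p) A"
  using assms by (simp add: valid_def derivable_asat)

end
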